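(* Let $\mathbf{B}\in\mathbb{C}^{n\times n}$ be decomposed as $\mathbf{B}=\mathbf{U}\,\mathrm{diag}\{\boldsymbol{\lambda}(\mathbf{B})\}\,\mathbf{V}^{*}$ where $\mathbf{U},\mathbf{V}\in\mathbb{C}^{n\times n}$ satisfy $\mathbf{U}\mathbf{V}^{*}=\mathbf{I}$ and $\boldsymbol{\lambda}(\mathbf{B})=(\lambda_\ell(\mathbf{B}))_{0\le \ell<n}\subset\mathbb{C}$. Write $\lambda_{\ell}(\mathbf{B})=|\lambda_{\ell}(\mathbf{B})|e^{i\theta_{\ell}}$ with $\theta_{\ell}\in[0,2\pi)$. Let $\mathbf{f},\mathbf{g}\in\mathbb{C}^{n\times1}$ be such that there exist $\mathbf{F},\mathbf{G}\in\mathbb{C}^{n\times1}$ satisfying $\mathbf{F}\circ\mathbf{G}\ne\mathbf{0}_{n\times1}$ and $$\mathbf{f}=\mathbf{V}\overline{\mathbf{F}},\qquad \mathbf{g}=\mathbf{U}\mathbf{G},\qquad \text{and for all } 0\le\ell<n,\ \ \mathbf{F}[\ell]\,\mathbf{G}[\ell]\,e^{i\theta_{\ell}}\in\mathbb{R}.$$ Then $$\min_{0\le\ell<n}\left\{|\lambda_{\ell}(\mathbf{B})|\,\mathrm{sgn}\!\left(\mathbf{F}[\ell]\mathbf{G}[\ell]e^{i\theta_{\ell}}\right)\right\}\le\frac{\mathbf{f}^{*}\mathbf{B}\mathbf{g}}{\sum_{0\le\ell<n}\left|\mathbf{F}[\ell]\mathbf{G}[\ell]\right|}\le\max_{0\l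e\ell<n}\left\{|\lambda_{\ell}(\mathbf{B})|\,\mathrm{sgn}\!\left(\mathbf{F}[\ell]\mathbf{G}[\ell]e^{i\theta_{\ell}}\right)\right\}.$$
   Context: Indices of vectors and matrices run over $0,\dots,n-1$; $\mathbf{F}[\ell]$ is the $\ell$-th entry of $\mathbf{F}$. $\mathbf{A}^{*}$ is the conjugate transpose of $\mathbf{A}$, $\overline{\mathbf{F}}$ is the entrywise complex conjugate, $\mathbf{I}$ is the identity matrix, $\mathrm{diag}\{\boldsymbol{\lambda}\}$ is the diagonal matrix with $\ell$-th diagonal entry $\lambda_\ell$, $\mathbf{0}_{n\times 1}$ is the zero vector, and $\circ$ is the Hadamard (entrywise) product. $\mathrm{sgn}$ is the sign of a real number, with $\mathrm{sgn}(0)=0$. *)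

theory Defs
  imports Complex_Main "Jordan_Normal_Form.Schur_Decomposition"
begin

definition hadamard_vec :: "complex vec \<Rightarrow> complex vec \<Rightarrow> complex vec" where
  "hadamard_vec F G = vec (dim_vec F) (\<lambda>l. F $ l * G $ l)"

(* Meant for the case that F[l] G[l] e^(i theta_l) is real, so that taking Re loses nothing
   and sgn is the real sign function (sgn on complex would be complex-valued). *)
definition signed_modulus ::
  "(nat \<Rightarrow> complex) \<Rightarrow> (nat \<Rightarrow> real) \<Rightarrow> complex vec \<Rightarrow> complex vec \<Rightarrow> nat \<Rightarrow> real" where
  "signed_modulus lam \<theta> F G l =
     cmod (lam l) * sgn (Re (F $ l * G $ l * exp (\<i> * complex_of_real (\<theta> l))))"

(* The complex number f* B g. *)
definition sesq_form :: "complex mat \<Rightarrow> complex vec \<Rightarrow> complex vec \<Rightarrow> complex" where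
  "sesq_form B f g = conjugate f \<bullet> (B *\<^sub>v g)"

end

theory Submission
  imports Defs
begin

text \<open>
  A square one-sided inverse is two-sided, so \<open>U V* = I\<close> also gives \<open>V* U = I\<close>: the columns of
  \<open>U\<close> and \<open>V\<close> are biorthogonal.  The coordinates of \<open>f\<close> in \<open>V\<close> and of \<open>g\<close> in \<open>U\<close> therefore
  diagonalise the form, \<open>f* B g = F\<^sup>T (V* U) diag(\<lambda>) (V* U) G = \<Sum>\<^sub>l \<lambda>\<^sub>l F\<^sub>l G\<^sub>l\<close>
  (lemma \<open>sesq_form_biorthogonal\<close>); no conjugate falls on \<open>F\<close> because \<open>f = V conj(F)\<close>.

  Since \<open>F\<^sub>l G\<^sub>l e\<^sup>i\<^sup>\<theta>\<close> is real with modulus \<open>|F\<^sub>l G\<^sub>l|\<close>, it equals its sign times that modulus, and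
  each summand is \<open>|F\<^sub>l G\<^sub>l|\<close> times the signed modulus of \<open>\<lambda>\<^sub>l\<close>
  (lemma \<open>eigenvalue_term_eq_signed_modulus\<close>).  So the quotient is
  the mean of the signed moduli with weights \<open>|F\<^sub>l G\<^sub>l|\<close>, which are nonnegative and do not all
  vanish; a weighted mean lies between the extreme values (lemma \<open>Min_le_weighted_mean_le_Max\<close>).
\<close>

lemma mat_adjoint_carrier:
  assumes "A \<in> carrier_mat n m"
  shows "mat_adjoint A \<in> carrier_mat m n"
  using assms by (auto simp: mat_adjoint_def mat_of_rows_def)

lemma mat_adjoint_index:
  assumes "i < dim_col A" and "j < dim_row A"
  shows "mat_adjoint A $$ (i, j) = conjugate (A $$ (j, i))"
  using assms unfolding mat_adjoint_def by (simp add: mat_of_rows_index)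

text \<open>
  This is adjointness, \<open>\<langle>A y, w\<rangle> = \<langle>y, A* w\<rangle>\<close> for \<open>y = conj(x)\<close>, in terms of the bilinear scalar
  product: the conjugate of the first argument of the inner product cancels the one in \<open>y\<close>.
\<close>

lemma conjugate_mult_conjugate_scalar_prod:
  fixes A :: "'a :: conjugatable_field mat"
  assumes A: "A \<in> carrier_mat n m" and x: "x \<in> carrier_vec m" and w: "w \<in> carrier_vec n"
  shows "conjugate (A *\<^sub>v conjugate x) \<bullet> w = x \<bullet> (mat_adjoint A *\<^sub>v w)"
proof -
  have adj: "mat_adjoint A \<in> carrier_mat m n"
    using A by (rule mat_adjoint_carrier)
  have "conjugate (A *\<^sub>v conjugate x) = transpose_mat (mat_adjoint A) *\<^sub>v x"
  proof (rule eq_vecI)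
    fix i assume "i < dim_vec (transpose_mat (mat_adjoint A) *\<^sub>v x)"
    then have i: "i < n" using adj by simp
    have row_A: "row A i \<in> carrier_vec m"
      using A i by simp
    have "conjugate (row A i) = col (mat_adjoint A) i"
      by (rule eq_vecI) (use A adj i in \<open>simp_all add: mat_adjoint_index\<close>)
    moreover have "(A *\<^sub>v conjugate x) $ i = row A i \<bullet> conjugate x"
      using A i by simp
    moreover have "conjugate (row A i \<bullet> conjugate x) = conjugate (row A i) \<bullet> x"
      using conjugate_sprod_vec[OF row_A, of "conjugate x"] x by simp
    ultimately show "conjugate (A *\<^sub>v conjugate x) $ i = (transpose_mat (mat_adjoint A) *\<^sub>v x) $ i"
      using A adj i by simp
  qed (use A adj in simp)
  then show ?thesis
    using transpose_vec_mult_scalar[OF adj w x] by simp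
qed

lemma mat_diag_mult_vec_index:
  fixes v :: "'a :: semiring_0 vec"
  assumes "v \<in> carrier_vec n" and "l < n"
  shows "(mat_diag n d *\<^sub>v v) $ l = d l * v $ l"
proof -
  have "(mat_diag n d *\<^sub>v v) $ l = (\<Sum>j<n. (if l = j then d j else 0) * v $ j)"
    using assms by (simp add: mat_diag_def scalar_prod_def atLeast0LessThan)
  also have "\<dots> = (\<Sum>j<n. if l = j then d j * v $ j else 0)"
    by (intro sum.cong) auto
  also have "\<dots> = d l * v $ l"
    using assms by simp
  finally show ?thesis .
qed

lemma sesq_form_biorthogonal:
  fixes U V :: "complex mat"
  assumes U: "U \<in> carrier_mat n n" and V: "V \<in> carrier_mat n n"
    and UV: "U * mat_adjoint V = 1\<^sub>m n"
    and F: "F \<in> carrier_vec n" and G: "G \<in> carrier_vec n"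
  shows "sesq_form (U * mat_diag n d * mat_adjoint V) (V *\<^sub>v conjugate F) (U *\<^sub>v G)
    = (\<Sum>l<n. d l * (F $ l * G $ l))"
proof -
  let ?W = "mat_adjoint V" and ?D = "mat_diag n d"
  have W: "?W \<in> carrier_mat n n"
    using V by (rule mat_adjoint_carrier)
  have WU: "?W * U = 1\<^sub>m n"
    using mat_mult_left_right_inverse[OF U W UV] .
  have cancel: "?W *\<^sub>v (U *\<^sub>v v) = v" if "v \<in> carrier_vec n" for v
    using that WU assoc_mult_mat_vec[OF W U that] by simp
  have DG: "?D *\<^sub>v G \<in> carrier_vec n"
    using mult_mat_vec_carrier[OF mat_diag_dim G] .
  have "(U * ?D * ?W) *\<^sub>v (U *\<^sub>v G) = (U * ?D) *\<^sub>v (?W *\<^sub>v (U *\<^sub>v G))"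
    by (rule assoc_mult_mat_vec[OF mult_carrier_mat[OF U mat_diag_dim] W mult_mat_vec_carrier[OF U G]])
  also have "\<dots> = U *\<^sub>v (?D *\<^sub>v G)"
    using cancel[OF G] assoc_mult_mat_vec[OF U mat_diag_dim G] by simp
  finally have Bg: "(U * ?D * ?W) *\<^sub>v (U *\<^sub>v G) = U *\<^sub>v (?D *\<^sub>v G)" .
  have "sesq_form (U * ?D * ?W) (V *\<^sub>v conjugate F) (U *\<^sub>v G)
      = F \<bullet> (?W *\<^sub>v (U *\<^sub>v (?D *\<^sub>v G)))"
    unfolding sesq_form_def Bg
    by (rule conjugate_mult_conjugate_scalar_prod[OF V F mult_mat_vec_carrier[OF U DG]])
  also have "\<dots> = F \<bullet> (?D *\<^sub>v G)"
    using cancel[OF DG] by simp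
  also have "\<dots> = (\<Sum>l<n. d l * (F $ l * G $ l))"
  proof -
    have "F \<bullet> (?D *\<^sub>v G) = (\<Sum>l<n. F $ l * (?D *\<^sub>v G) $ l)"
      unfolding scalar_prod_def carrier_vecD[OF DG] atLeast0LessThan ..
    also have "\<dots> = (\<Sum>l<n. d l * (F $ l * G $ l))"
      by (intro sum.cong refl) (simp only: mat_diag_mult_vec_index[OF G] lessThan_iff mult_ac)
    finally show ?thesis .
  qed
  finally show ?thesis .
qed

text \<open>
  The unit factor \<open>e\<^sup>i\<^sup>\<theta>\<close> is taken from the eigenvalue and given to \<open>F\<^sub>l G\<^sub>l\<close>: this makes the latter
  real without changing its modulus, and a real number is its sign times its absolute value.
\<close>

lemma eigenvalue_term_eq_signed_modulus:
  assumes polar: "lam l = complex_of_real (cmod (lam l)) * exp (\<i> * complex_of_real (\<theta> l))"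
    and real: "F $ l * G $ l * exp (\<i> * complex_of_real (\<theta> l)) \<in> \<real>"
  shows "lam l * (F $ l * G $ l)
    = complex_of_real (cmod (F $ l * G $ l) * signed_modulus lam \<theta> F G l)"
proof -
  define z where "z = F $ l * G $ l * exp (\<i> * complex_of_real (\<theta> l))"
  obtain r where z: "z = complex_of_real r"
    using real unfolding z_def by (auto elim: Reals_cases)
  have "cmod z = cmod (F $ l * G $ l)"
    unfolding z_def by (simp add: norm_mult)
  then have abs_r: "\<bar>r\<bar> = cmod (F $ l * G $ l)"
    unfolding z by simp
  have "lam l * (F $ l * G $ l) = complex_of_real (cmod (lam l)) * z"
    by (subst polar) (simp add: z_def)
  also have "\<dots> = complex_of_real (cmod (lam l) * (sgn r * \<bar>r\<bar>))"
    by (simp add: z sgn_mult_abs)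
  also have "\<dots> = complex_of_real (cmod (F $ l * G $ l) * signed_modulus lam \<theta> F G l)"
    unfolding signed_modulus_def abs_r z_def[symmetric] z by (simp add: mult_ac)
  finally show ?thesis .
qed

lemma Min_le_weighted_mean_le_Max:
  fixes w c :: "'a \<Rightarrow> real"
  assumes fin: "finite A" and nonneg: "\<And>x. x \<in> A \<Longrightarrow> 0 \<le> w x" and pos: "0 < sum w A"
  shows "(MIN x\<in>A. c x) \<le> (\<Sum>x\<in>A. w x * c x) / sum w A"
    and "(\<Sum>x\<in>A. w x * c x) / sum w A \<le> (MAX x\<in>A. c x)"
proof -
  have "(MIN x\<in>A. c x) * sum w A \<le> (\<Sum>x\<in>A. w x * c x)"
    unfolding sum_distrib_left using fin nonneg
    by (intro sum_mono) (subst mult.commute, auto intro!: mult_left_mono)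
  then show "(MIN x\<in>A. c x) \<le> (\<Sum>x\<in>A. w x * c x) / sum w A"
    using pos by (simp add: pos_le_divide_eq)
  have "(\<Sum>x\<in>A. w x * c x) \<le> (MAX x\<in>A. c x) * sum w A"
    unfolding sum_distrib_left using fin nonneg
    by (intro sum_mono) (subst (2) mult.commute, auto intro!: mult_left_mono)
  then show "(\<Sum>x\<in>A. w x * c x) / sum w A \<le> (MAX x\<in>A. c x)"
    using pos by (simp add: pos_divide_le_eq)
qed

theorem theorem2p1:
  fixes n :: nat
    and B U V :: "complex mat"
    and lam :: "nat \<Rightarrow> complex"
    and \<theta> :: "nat \<Rightarrow> real"
    and f g F G :: "complex vec"
  assumes "B \<in> carrier_mat n n" and "U \<in> carrier_mat n n" and "V \<in> carrier_mat n n"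
    and "B = U * mat_diag n lam * mat_adjoint V"
    and "U * mat_adjoint V = 1\<^sub>m n"
    and "\<And>l. l < n \<Longrightarrow> 0 \<le> \<theta> l \<and> \<theta> l < 2 * pi"
    and "\<And>l. l < n \<Longrightarrow>
           lam l = complex_of_real (cmod (lam l)) * exp (\<i> * complex_of_real (\<theta> l))"
    and "f \<in> carrier_vec n" and "g \<in> carrier_vec n"
    and "F \<in> carrier_vec n" and "G \<in> carrier_vec n"
    and "hadamard_vec F G \<noteq> 0\<^sub>v n"
    and "f = V *\<^sub>v conjugate F" and "g = U *\<^sub>v G"
    and "\<And>l. l < n \<Longrightarrow> F $ l * G $ l * exp (\<i> * complex_of_real (\<theta> l)) \<in> \<real>"
  shows "sesq_form B f g / complex_of_real (\<Sum>l<n. cmod (F $ l * G $ l)) \<in> \<real>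
    \<and> (MIN l\<in>{..<n}. signed_modulus lam \<theta> F G l)
        \<le> Re (sesq_form B f g / complex_of_real (\<Sum>l<n. cmod (F $ l * G $ l)))
    \<and> Re (sesq_form B f g / complex_of_real (\<Sum>l<n. cmod (F $ l * G $ l)))
        \<le> (MAX l\<in>{..<n}. signed_modulus lam \<theta> F G l)"
proof -
  let ?w = "\<lambda>l. cmod (F $ l * G $ l)" and ?c = "signed_modulus lam \<theta> F G"
  have "sesq_form B f g = (\<Sum>l<n. lam l * (F $ l * G $ l))"
    unfolding assms(4,13,14) by (rule sesq_form_biorthogonal[OF assms(2,3,5,10,11)])
  also have "\<dots> = complex_of_real (\<Sum>l<n. ?w l * ?c l)"
    unfolding of_real_sum
    by (intro sum.cong refl eigenvalue_term_eq_signed_modulus) (use assms(7,15) in auto)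
  finally have quotient: "sesq_form B f g / complex_of_real (\<Sum>l<n. ?w l)
      = complex_of_real ((\<Sum>l<n. ?w l * ?c l) / (\<Sum>l<n. ?w l))"
    by (simp only: of_real_divide)
  obtain k where "k < n" and "F $ k * G $ k \<noteq> 0"
  proof (rule ccontr)
    assume "\<not> thesis"
    with that have "F $ l * G $ l = 0" if "l < n" for l
      using \<open>l < n\<close> by blast
    then have "hadamard_vec F G = 0\<^sub>v n"
      using assms(10) unfolding hadamard_vec_def by (intro eq_vecI) auto
    with assms(12) show False by contradiction
  qed
  then have "0 < (\<Sum>l<n. ?w l)"
    by (intro sum_pos2[of _ k]) (auto simp: zero_less_mult_iff)
  then show ?thesis
    unfolding quotient Re_complex_of_real
    by (intro conjI Reals_of_real Min_le_weighted_mean_le_Max) auto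
qed

end
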